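(* Let the real polynomial $p(z)=\sum_{j=0}^{n} a_j z^j$ with $n \geq 3$ have positive coefficients. Let $0<\varepsilon\leq 1$, and define $$\gamma_1=\frac{(1-\varepsilon)a_{n-2}}{a_n}\quad\text{and}\quad \gamma_0=\max\left\{0,\ \max_{0\leq j\leq n-3}\frac{a_j-\gamma_1 a_{j+2}}{a_{j+3}}\right\}.$$ Let $\mu$ be the unique positive zero of $z^3-\gamma_1 z-\gamma_0$, let $R=\mu^3+\frac{a_{n-1}}{a_n}\mu^2+\varepsilon\frac{a_{n-2}}{a_n}\mu$, and let $c_1(\varepsilon)$ and $c_2(\varepsilon)$ be the zeros of the quadratic $z^2+\frac{a_{n-1}}{a_n}z+\varepsilon\frac{a_{n-2}}{a_n}$. Then all the zeros of $p$ are included in the union of disks $$\{z\in\mathbb{C}:|z|\leq R^{1/3}\}\ \cup\ \{z\in\mathbb{C}:|z-c_1(\varepsilon)|\leq R^{1/3}\}\ \cup\ \{z\in\mathbb{C}:|z-c_2(\varepsilon)|\leq R^{1/3}\}.$$ There exist only the following two scenarios for disks to be disjoint. (1) The disk centered at the origin is disjoint from the other two, in which case that disk contains $n-2$ zeros of $p$, while the union of the other two contains the two remaining zeros of $p$. If these are also disjoint, then each contains one zero of $p$. (2) The two disks not centered at the origin are disjoint, but only one of them is disjoint from the disk at the origin, in which case that disk contains one zero of $p$, while the union of the other two contains $n-1$ zeros of $p$. This scenario is only possible when $c_1(\varepsilon)$ and $c_2(\varepsilon)$ are real and negative.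
   Context: Zeros are zeros in the complex plane $\mathbb{C}$.
   Formalization: "Only the following two scenarios for disks to be disjoint" is stated for the case that one disk is disjoint from both others; for mere pairwise disjointness it is false (n=3, ε=1, a=(0.074, 2.25, 0.01, 1): the two noncentral disks are disjoint but both meet the disk at the origin). *)

theory Defs
  imports "HOL-Computational_Algebra.Computational_Algebra" "HOL-Analysis.Analysis"
begin

definition gamma1 :: "(nat \<Rightarrow> real) \<Rightarrow> nat \<Rightarrow> real \<Rightarrow> real" where
  "gamma1 a n \<epsilon> = (1 - \<epsilon>) * a (n - 2) / a n"

definition gamma0 :: "(nat \<Rightarrow> real) \<Rightarrow> nat \<Rightarrow> real \<Rightarrow> real" where
  "gamma0 a n \<epsilon> =
     max 0 (Max ((\<lambda>j. (a j - gamma1 a n \<epsilon> * a (j + 2)) / a (j + 3)) ` {0..n - 3}))"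

(* Zeros are counted with multiplicity. *)
definition zeros_in :: "complex poly \<Rightarrow> complex set \<Rightarrow> nat" where
  "zeros_in p S = size {#z \<in># proots p. z \<in> S#}"

definition scenario1 :: "'a set \<Rightarrow> 'a set \<Rightarrow> 'a set \<Rightarrow> bool" where
  "scenario1 D0 D1 D2 \<longleftrightarrow> disjnt D0 D1 \<and> disjnt D0 D2"

(* Directed version: D is the disk that is disjoint from D0, and E the one that is not.
   The scenario occurs for the unordered pair D1, D2 iff it does for (D1, D2) or (D2, D1). *)
definition scenario2 :: "'a set \<Rightarrow> 'a set \<Rightarrow> 'a set \<Rightarrow> bool" where
  "scenario2 D0 D E \<longleftrightarrow> disjnt D E \<and> disjnt D D0 \<and> \<not> disjnt E D0"

(* A disk separates from the others.  Disjointness of just one pair does not suffice: two disks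
   that do not meet may both meet the third one, so that the union is still in one piece. *)
definition some_disk_isolated :: "'a set \<Rightarrow> 'a set \<Rightarrow> 'a set \<Rightarrow> bool" where
  "some_disk_isolated D0 D1 D2 \<longleftrightarrow>
     disjnt D0 (D1 \<union> D2) \<or> disjnt D1 (D0 \<union> D2) \<or> disjnt D2 (D0 \<union> D1)"

end

theory Submission
  imports Defs "HOL-Complex_Analysis.Complex_Analysis"
begin

text \<open>
  Why the theorem holds. Multiply \<open>p\<close> by the cubic \<open>h(z) = z^3 - \<gamma>\<^sub>1 z - \<gamma>\<^sub>0\<close>. The
  coefficient of \<open>z^(j+3)\<close> in the product is \<open>a\<^sub>j - \<gamma>\<^sub>1 a\<^sub>j\<^sub>+\<^sub>2 - \<gamma>\<^sub>0 a\<^sub>j\<^sub>+\<^sub>3\<close> (with \<open>a\<^sub>k = 0\<close> for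
  indices outside \<open>0..n\<close>), and \<open>\<gamma>\<^sub>0\<close>, \<open>\<gamma>\<^sub>1\<close> are chosen so that all but the three leading ones
  are nonpositive. Those three form \<open>f(z) = a\<^sub>n z^(n+1) (z - c\<^sub>1) (z - c\<^sub>2)\<close>, so \<open>h p = f + g\<close>
  where \<open>g\<close> has degree at most \<open>n\<close> and nonpositive coefficients
  (\<open>cubic_product_remainder_nonpos\<close>).

  Since the coefficients of \<open>g\<close> have one sign, the triangle inequality for \<open>|g|\<close> is an equality on
  the positive axis, and beyond \<open>\<mu>\<close> the value \<open>|g|\<close> grows at most like the power \<open>n\<close>
  (\<open>nonpos_coeffs_growth\<close>). As \<open>h(\<mu>) = 0\<close>, one has \<open>|g(\<mu>)| = f(\<mu>) = a\<^sub>n \<mu>^n R\<close>, hence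
  \<open>|g(z)| \<le> a\<^sub>n |z|^n R\<close> whenever \<open>|z| \<ge> \<mu>\<close>. Outside the three disks the product
  \<open>|z| |z - c\<^sub>1| |z - c\<^sub>2|\<close> exceeds \<open>R\<close>, and \<open>R \<ge> \<mu>^3\<close> makes \<open>|z| > \<mu>\<close> there, so that
  \<open>|g| < |f|\<close> (\<open>dominated_outside_disks\<close>). In particular \<open>p\<close> has no zero outside.

  For the counts, this strict domination and Rouche's theorem on a slightly larger circle show that
  an isolated disk contains as many zeros of \<open>h p\<close> as of \<open>f\<close> (\<open>zeros_in_isolated_disk\<close>). The
  zeros of \<open>f\<close> are the centres, with multiplicities \<open>n + 1\<close>, \<open>1\<close>, \<open>1\<close>, and the three zeros of
  \<open>h\<close> lie in the disk at the origin (\<open>cubic_roots_bound\<close>); subtracting them leaves \<open>n - 2\<close>, \<open>1\<close>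
  or \<open>1\<close> zeros of \<open>p\<close>. The union of the two remaining disks holds all the other zeros, so its count
  follows from the degree.

  Finally, if \<open>c\<^sub>1\<close> and \<open>c\<^sub>2\<close> are not real, they are conjugate and equally far from the origin, so
  both or neither of their disks meet the one at the origin.
\<close>

section \<open>Counting the zeros of polynomials\<close>

lemma zeros_in_mult:
  assumes "p \<noteq> 0" "q \<noteq> 0"
  shows "zeros_in (p * q) S = zeros_in p S + zeros_in q S"
  using assms by (simp add: zeros_in_def proots_mult)

lemma zeros_in_smult: "c \<noteq> 0 \<Longrightarrow> zeros_in (smult c p) S = zeros_in p S"
  by (simp add: zeros_in_def)

lemma zeros_in_linear: "zeros_in [:- c, 1:] S = (if c \<in> S then 1 else 0)"
  by (simp add: zeros_in_def)

lemma zeros_in_power: "zeros_in (p ^ k) S = k * zeros_in p S"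
  unfolding zeros_in_def proots_power by (induction k) auto

lemma zeros_in_cong:
  assumes "\<And>z. poly p z = 0 \<Longrightarrow> z \<in> S \<longleftrightarrow> z \<in> T"
  shows "zeros_in p S = zeros_in p T"
proof (cases "p = 0")
  case False
  have "{#z \<in># proots p. z \<in> S#} = {#z \<in># proots p. z \<in> T#}"
    using assms False by (intro filter_mset_cong) auto
  thus ?thesis by (simp add: zeros_in_def)
qed (simp add: zeros_in_def)

lemma zeros_in_add_compl: "zeros_in p S + zeros_in p (- S) = degree p"
  using size_proots_complex[of p] multiset_partition[of "proots p" "\<lambda>z. z \<in> S"]
  by (metis (no_types, lifting) ComplD ComplI filter_mset_cong size_union zeros_in_def)

lemma zeros_in_complementary:
  assumes "{z. poly p z = 0} \<subseteq> S \<union> T" "disjnt S T"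
  shows "zeros_in p T = degree p - zeros_in p S"
proof -
  have "zeros_in p T = zeros_in p (- S)"
    using assms by (intro zeros_in_cong) (auto simp: disjnt_def)
  thus ?thesis using zeros_in_add_compl[of p S] by linarith
qed

lemma zeros_in_superset:
  assumes "{z. poly p z = 0} \<subseteq> S"
  shows "zeros_in p S = degree p"
proof -
  have "zeros_in p (- S) = zeros_in p {}"
    using assms by (intro zeros_in_cong) auto
  also have "\<dots> = 0" by (simp add: zeros_in_def)
  finally show ?thesis using zeros_in_add_compl[of p S] by simp
qed

lemma zeros_in_eq_sum_order:
  assumes "p \<noteq> 0"
  shows "zeros_in p S = (\<Sum>z\<in>{z. poly p z = 0 \<and> z \<in> S}. order z p)"
  using assms unfolding zeros_in_def size_multiset_overloaded_eq
  by (intro sum.cong) auto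

lemma zorder_poly:
  assumes "p \<noteq> 0"
  shows "zorder (poly p) z = int (order z p)"
proof -
  obtain q where q: "p = [:- z, 1:] ^ order z p * q" "\<not> [:- z, 1:] dvd q"
    using order_decomp[OF assms] by blast
  show ?thesis
  proof (rule zorder_eqI[where S = UNIV and g = "poly q"])
    show "poly q z \<noteq> 0" using q(2) by (simp add: poly_eq_0_iff_dvd)
    show "poly p w = poly q w * (w - z) powi int (order z p)" for w
      by (subst (1) q(1)) (simp add: mult.commute)
  qed (auto intro: holomorphic_intros)
qed

text \<open>
  On a circle the winding numbers in Rouche's theorem are 1 inside and 0 outside, and
  \<open>zorder_poly\<close> turns its weighted sums over zeros into counts with multiplicity.
\<close>
lemma Rouche_polynomials:
  assumes "0 < s" and less: "\<And>z. z \<in> sphere x s \<Longrightarrow> cmod (poly g z) < cmod (poly f z)"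
  shows "zeros_in (f + g) (ball x s) = zeros_in f (ball x s)"
proof -
  let ?\<gamma> = "circlepath x s"
  have "x + s \<in> sphere x s" using \<open>0 < s\<close> by (simp add: dist_norm)
  from less[OF this] have nz: "f \<noteq> 0" "f + g \<noteq> 0"
    by (auto simp: add_eq_0_iff)
  have count: "(\<Sum>z\<in>{z\<in>UNIV. poly h z = 0}. winding_number ?\<gamma> z * zorder (poly h) z)
      = of_nat (zeros_in h (ball x s))"
    if "h \<noteq> 0" and off: "\<And>z. z \<in> sphere x s \<Longrightarrow> poly h z \<noteq> 0" for h
  proof -
    have wn: "winding_number ?\<gamma> z = (if z \<in> ball x s then 1 else 0)" if "poly h z = 0" for z
    proof -
      have "z \<notin> sphere x s" using off that by blast
      then consider "z \<in> ball x s" | "z \<notin> cball x s"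
        by (auto simp: le_less)
      thus ?thesis
      proof cases
        case 1
        thus ?thesis by (simp add: winding_number_circlepath dist_norm norm_minus_commute)
      next
        case 2
        have "winding_number ?\<gamma> z = 0"
          using 2 \<open>0 < s\<close> by (intro winding_number_zero_outside[where s = "cball x s"]) auto
        thus ?thesis using 2 by auto
      qed
    qed
    have fin: "finite {z. poly h z = 0}" using \<open>h \<noteq> 0\<close> by (rule poly_roots_finite)
    have "(\<Sum>z\<in>{z\<in>UNIV. poly h z = 0}. winding_number ?\<gamma> z * zorder (poly h) z)
        = (\<Sum>z\<in>{z. poly h z = 0}. if z \<in> ball x s then of_nat (order z h) else 0)"
      by (intro sum.cong) (auto simp: wn zorder_poly[OF \<open>h \<noteq> 0\<close>])
    also have "\<dots> = (\<Sum>z\<in>{z. poly h z = 0 \<and> z \<in> ball x s}. of_nat (order z h))"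
      using fin by (subst sum.inter_filter[symmetric]) auto
    finally show ?thesis by (simp add: zeros_in_eq_sum_order[OF \<open>h \<noteq> 0\<close>])
  qed
  have off: "poly f z \<noteq> 0" "poly (f + g) z \<noteq> 0" if "z \<in> sphere x s" for z
    using less[OF that] by (auto simp: add_eq_0_iff)
  have "(\<Sum>z\<in>{z\<in>UNIV. poly f z + poly g z = 0}.
          winding_number ?\<gamma> z * zorder (\<lambda>z. poly f z + poly g z) z)
      = (\<Sum>z\<in>{z\<in>UNIV. poly f z = 0}. winding_number ?\<gamma> z * zorder (poly f) z)"
  proof (rule Rouche_theorem)
    show "finite {z\<in>UNIV. poly f z + poly g z = 0}"
      using poly_roots_finite[OF nz(2)] by simp
    show "finite {z\<in>UNIV. poly f z = 0}"
      using poly_roots_finite[OF nz(1)] by simp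
  qed (use less \<open>0 < s\<close> in \<open>auto intro!: holomorphic_intros\<close>)
  hence "of_nat (zeros_in (f + g) (ball x s)) = (of_nat (zeros_in f (ball x s)) :: complex)"
    using count[OF nz(1) off(1)] count[OF nz(2) off(2)]
    by (simp add: poly_add[abs_def] cong: sum.cong)
  thus ?thesis by simp
qed

text \<open>
  The domination is only available outside the closed disk, not on its boundary. As \<open>T\<close> has
  positive distance from the disk, a slightly larger circle still avoids \<open>T\<close>, and Rouche's theorem
  applies there; the annulus in between contributes no zeros.
\<close>
lemma zeros_in_isolated_disk:
  assumes "0 \<le> r" "closed T" "disjnt (cball x r) T"
    and less: "\<And>z. z \<notin> cball x r \<Longrightarrow> z \<notin> T \<Longrightarrow> cmod (poly g z) < cmod (poly f z)"
  shows "zeros_in (f + g) (cball x r) = zeros_in f (cball x r)"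
proof -
  obtain s where "r < s" and s: "disjnt (cball x s) T"
  proof (cases "T = {}")
    case False
    then obtain y where y: "y \<in> T" "infdist x T = dist x y"
      using infdist_attains_inf[OF \<open>closed T\<close>] by metis
    have "r < dist x y" using assms(3) y(1) by (auto simp: disjnt_iff not_le)
    moreover have "dist x y \<le> dist x z" if "z \<in> T" for z
      using infdist_le[OF that, of x] y(2) by simp
    ultimately show ?thesis
      by (intro that[of "(r + dist x y) / 2"]) (fastforce simp: disjnt_def)+
  qed (use that[of "r + 1"] in simp)
  have big: "zeros_in h (cball x r) = zeros_in h (ball x s)"
    if "\<And>z. z \<notin> cball x r \<Longrightarrow> z \<notin> T \<Longrightarrow> poly h z \<noteq> 0" for h
    using that s \<open>r < s\<close> by (intro zeros_in_cong) (force simp: disjnt_def)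
  have "zeros_in (f + g) (ball x s) = zeros_in f (ball x s)"
  proof (rule Rouche_polynomials)
    fix z assume "z \<in> sphere x s"
    thus "cmod (poly g z) < cmod (poly f z)"
      using s \<open>r < s\<close> by (intro less) (auto simp: disjnt_def)
  qed (use \<open>0 \<le> r\<close> \<open>r < s\<close> in simp)
  moreover have "poly f z \<noteq> 0" "poly (f + g) z \<noteq> 0" if "z \<notin> cball x r" "z \<notin> T" for z
    using less[OF that] by (auto simp: add_eq_0_iff)
  ultimately show ?thesis using big[of f] big[of "f + g"] by simp
qed

section \<open>The cubic multiplier\<close>

text \<open>
  Dividing by \<open>x\<close> explains the sign: \<open>x\<^sup>2\<close> increases, whereas \<open>\<alpha> + \<beta> / x\<close> does not. Both the
  uniqueness of the positive root and the bound on the complex roots rest on this.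
\<close>
lemma cubic_positive_beyond:
  fixes u x :: real
  assumes "0 \<le> \<alpha>" "0 \<le> \<beta>" "0 < u" "u < x" "\<alpha> * u + \<beta> \<le> u ^ 3"
  shows "\<alpha> * x + \<beta> < x ^ 3"
proof -
  have "u * (\<alpha> * x + \<beta>) = x * (\<alpha> * u) + u * \<beta>" by (simp add: algebra_simps)
  also have "\<dots> \<le> x * (\<alpha> * u) + x * \<beta>"
    using assms by (intro add_left_mono mult_right_mono) auto
  also have "\<dots> = x * (\<alpha> * u + \<beta>)" by (simp add: algebra_simps)
  also have "\<dots> \<le> x * u ^ 3" using assms by (intro mult_left_mono) auto
  also have "\<dots> = u * (x * u\<^sup>2)" by (simp add: power2_eq_square power3_eq_cube)
  also have "\<dots> < u * (x * x\<^sup>2)"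
    using assms by (intro mult_strict_left_mono power_strict_mono) auto
  also have "x * x\<^sup>2 = x ^ 3" by (simp add: power2_eq_square power3_eq_cube)
  finally show ?thesis using \<open>0 < u\<close> by simp
qed

lemma cubic_unique_positive_root:
  fixes \<alpha> \<beta> :: real
  assumes "0 \<le> \<alpha>" "0 \<le> \<beta>" "\<alpha> \<noteq> 0 \<or> \<beta> \<noteq> 0"
  shows "\<exists>!x. 0 < x \<and> x ^ 3 - \<alpha> * x - \<beta> = 0"
proof -
  have "\<exists>x>0. x ^ 3 - \<alpha> * x - \<beta> = 0"
  proof (cases "\<beta> = 0")
    case True
    hence "0 < \<alpha>" using assms by auto
    hence "sqrt \<alpha> ^ 3 = \<alpha> * sqrt \<alpha>" by (simp add: power3_eq_cube)
    thus ?thesis using \<open>0 < \<alpha>\<close> True by (intro exI[of _ "sqrt \<alpha>"]) auto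
  next
    case False
    \<comment> \<open>The right end point \<open>m\<close> satisfies \<open>m \<ge> 1\<close> and \<open>m \<ge> \<alpha> + \<beta>\<close>, so \<open>m^3\<close> dominates \<open>\<alpha> m + \<beta>\<close>.\<close>
    let ?h = "\<lambda>x. x ^ 3 - \<alpha> * x - \<beta>" and ?m = "1 + \<alpha> + \<beta>"
    have "\<alpha> * ?m + \<beta> \<le> (\<alpha> + \<beta>) * ?m" using assms by (simp add: algebra_simps)
    also have "\<dots> \<le> ?m * ?m\<^sup>2" using assms
      by (simp add: algebra_simps power2_eq_square)
    finally have "0 \<le> ?h ?m" by (simp add: power2_eq_square power3_eq_cube)
    moreover have "?h 0 \<le> 0" using assms by simp
    moreover have "continuous_on {0..?m} ?h" by (intro continuous_intros)
    ultimately have "\<exists>x\<ge>0. x \<le> ?m \<and> ?h x = 0" using assms by (intro IVT') auto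
    then obtain x where "0 \<le> x" "?h x = 0" by blast
    moreover have "x \<noteq> 0" using \<open>?h x = 0\<close> False by auto
    ultimately show ?thesis by (intro exI[of _ x]) auto
  qed
  moreover have "x = y" if "0 < x" "x ^ 3 - \<alpha> * x - \<beta> = 0" "0 < y" "y ^ 3 - \<alpha> * y - \<beta> = 0" for x y
    using cubic_positive_beyond[OF assms(1,2), of x y] cubic_positive_beyond[OF assms(1,2), of y x] that
    by (cases x y rule: linorder_cases) auto
  ultimately show ?thesis by blast
qed

lemma cubic_roots_bound:
  fixes \<alpha> \<beta> \<mu> :: real and z :: complex
  assumes "0 \<le> \<alpha>" "0 \<le> \<beta>" "0 < \<mu>" "\<mu> ^ 3 - \<alpha> * \<mu> - \<beta> = 0"
    and "z ^ 3 - of_real \<alpha> * z - of_real \<beta> = 0"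
  shows "cmod z \<le> \<mu>"
proof (rule ccontr)
  assume "\<not> cmod z \<le> \<mu>"
  hence "\<alpha> * cmod z + \<beta> < cmod z ^ 3"
    using assms by (intro cubic_positive_beyond[of _ _ \<mu>]) auto
  also have "\<dots> = cmod (of_real \<alpha> * z + of_real \<beta>)"
    using assms(5) by (simp flip: norm_power add: algebra_simps)
  also have "\<dots> \<le> \<alpha> * cmod z + \<beta>"
    using norm_triangle_ineq[of "of_real \<alpha> * z" "of_real \<beta>"] assms by (simp add: norm_mult)
  finally show False by simp
qed

section \<open>Domination outside the three disks\<close>

text \<open>
  With \<open>b\<^sub>k \<ge> 0\<close> the negated coefficients, \<open>|g(z)| \<le> \<Sum> b\<^sub>k |z|^k\<close>, with equality at \<open>\<mu>\<close>. Each
  term grows by the factor \<open>(|z| / \<mu>)^k \<le> (|z| / \<mu>)^n\<close> on passing from \<open>\<mu>\<close> to \<open>|z|\<close>.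
\<close>
lemma nonpos_coeffs_growth:
  fixes g :: "complex poly"
  assumes nonpos: "\<And>k. coeff g k \<in> \<real>\<^sub>\<le>\<^sub>0" and deg: "degree g \<le> n" and "0 < \<mu>" "\<mu> \<le> cmod z"
  shows "\<mu> ^ n * cmod (poly g z) \<le> cmod z ^ n * cmod (poly g (of_real \<mu>))"
proof -
  define b where "b k = - Re (coeff g k)" for k
  have b: "coeff g k = - of_real (b k)" "0 \<le> b k" for k
    using nonpos[of k] by (auto simp: b_def nonpos_Reals_def)
  have expand: "poly g w = - (\<Sum>k\<le>n. of_real (b k) * w ^ k)" for w
  proof -
    have "poly g w = (\<Sum>k\<le>degree g. coeff g k * w ^ k)" by (rule poly_altdef)
    also have "\<dots> = (\<Sum>k\<le>n. coeff g k * w ^ k)"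
      using deg by (intro sum.mono_neutral_left) (auto simp: coeff_eq_0)
    finally show ?thesis by (simp add: b(1) sum_negf)
  qed
  have "poly g (of_real \<mu>) = - of_real (\<Sum>k\<le>n. b k * \<mu> ^ k)"
    by (simp add: expand)
  moreover have "0 \<le> (\<Sum>k\<le>n. b k * \<mu> ^ k)"
    using b(2) \<open>0 < \<mu>\<close> by (intro sum_nonneg) auto
  ultimately have at_mu: "cmod (poly g (of_real \<mu>)) = (\<Sum>k\<le>n. b k * \<mu> ^ k)"
    by (simp only: norm_minus_cancel norm_of_real abs_of_nonneg)
  have "cmod (poly g z) \<le> (\<Sum>k\<le>n. b k * cmod z ^ k)"
    unfolding expand norm_minus_cancel
    by (rule order_trans[OF norm_sum]) (simp add: norm_mult norm_power b(2))
  hence "\<mu> ^ n * cmod (poly g z) \<le> (\<Sum>k\<le>n. b k * (\<mu> ^ n * cmod z ^ k))"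
    using \<open>0 < \<mu>\<close> mult_left_mono[of "cmod (poly g z)" "\<Sum>k\<le>n. b k * cmod z ^ k" "\<mu> ^ n"]
    by (simp add: sum_distrib_left mult.left_commute)
  also have "\<dots> \<le> (\<Sum>k\<le>n. b k * (cmod z ^ n * \<mu> ^ k))"
  proof (intro sum_mono mult_left_mono b(2))
    fix k assume "k \<in> {..n}"
    hence split: "w ^ n = w ^ k * w ^ (n - k)" for w :: real
      by (simp flip: power_add)
    have "\<mu> ^ (n - k) \<le> cmod z ^ (n - k)"
      using assms by (intro power_mono) auto
    thus "\<mu> ^ n * cmod z ^ k \<le> cmod z ^ n * \<mu> ^ k"
      unfolding split using \<open>0 < \<mu>\<close>
      by (simp add: mult_ac mult_left_mono)
  qed
  finally show ?thesis by (simp add: at_mu sum_distrib_left mult_ac)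
qed

text \<open>
  This is where the values of \<open>\<gamma>\<^sub>1\<close> and \<open>\<gamma>\<^sub>0\<close> come from: \<open>\<gamma>\<^sub>1\<close> leaves exactly the fraction
  \<open>\<epsilon>\<close> of \<open>a\<^sub>n\<^sub>-\<^sub>2\<close> in the coefficient of \<open>z^(n+1)\<close>, and \<open>\<gamma>\<^sub>0\<close> is the least nonnegative number
  making the coefficients of \<open>z^3, ..., z^n\<close> nonpositive. Those of \<open>1, z, z\<^sup>2\<close> receive nothing
  from \<open>z^3 p\<close> and are therefore nonpositive anyway.
\<close>
lemma cubic_product_remainder_nonpos:
  fixes a :: "nat \<Rightarrow> real"
  assumes n: "n \<ge> 3" and pos: "\<forall>j\<le>n. a j > 0" and eps: "0 < \<epsilon>" "\<epsilon> \<le> 1"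
    and p: "p = (\<Sum>j\<le>n. monom (complex_of_real (a j)) j)"
    and f: "f = smult (of_real (a n)) ([:0, 1:] ^ (n + 1) *
       [:of_real (\<epsilon> * (a (n - 2) / a n)), of_real (a (n - 1) / a n), 1:])"
    and g: "g = [:- of_real (gamma0 a n \<epsilon>), - of_real (gamma1 a n \<epsilon>), 0, 1:] * p - f"
  shows "coeff g k \<in> \<real>\<^sub>\<le>\<^sub>0" and "degree g \<le> n"
proof -
  let ?\<beta> = "gamma0 a n \<epsilon>" and ?\<alpha> = "gamma1 a n \<epsilon>"
  \<comment> \<open>The coefficients extended by 0, so that the product formula below has no boundary cases at \<open>n\<close>.\<close>
  define A where "A k = (if k \<le> n then a k else 0)" for k
  have "a n > 0" "a (n - 2) > 0" using pos by auto
  have \<alpha>: "?\<alpha> \<ge> 0" "?\<alpha> * a n = (1 - \<epsilon>) * a (n - 2)"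
    using \<open>a n > 0\<close> \<open>a (n - 2) > 0\<close> eps by (auto simp: gamma1_def)
  have \<beta>: "?\<beta> \<ge> 0" by (simp add: gamma0_def)
  have A: "A k \<ge> 0" for k using pos by (simp add: A_def less_imp_le)
  have step: "a j - ?\<alpha> * a (j + 2) - ?\<beta> * a (j + 3) \<le> 0" if "j \<le> n - 3" for j
  proof -
    have "(a j - ?\<alpha> * a (j + 2)) / a (j + 3) \<le> ?\<beta>"
      using that unfolding gamma0_def by (intro max.coboundedI2 Max_ge) auto
    moreover have "a (j + 3) > 0" using pos n that by auto
    ultimately show ?thesis by (simp add: field_simps)
  qed
  have cp: "coeff p k = of_real (A k)" for k
    unfolding p A_def by (simp add: coeff_sum)
  have cf: "coeff f k = of_real (if k = n + 3 then a n else if k = n + 2 then a (n - 1)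
      else if k = n + 1 then \<epsilon> * a (n - 2) else 0)" for k
  proof -
    let ?Q = "[:of_real (\<epsilon> * (a (n - 2) / a n)), of_real (a (n - 1) / a n), 1 :: complex:]"
    have Q: "coeff ?Q i = of_real (if i = 0 then \<epsilon> * (a (n - 2) / a n)
        else if i = 1 then a (n - 1) / a n else if i = 2 then 1 else 0)" for i
      by (auto simp: coeff_pCons split: nat.split)
    have "[:0, 1:] ^ (n + 1) = monom (1 :: complex) (n + 1)" by (simp add: monom_altdef)
    hence coeff_f: "coeff f k = of_real (a n) * (if k < n + 1 then 0 else coeff ?Q (k - (n + 1)))"
      by (simp only: f coeff_smult coeff_monom_mult) simp
    consider "k < n + 1" | "k = n + 1" | "k = n + 2" | "k = n + 3" | "k > n + 3"
      by linarith
    thus ?thesis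
      using \<open>a n > 0\<close> unfolding coeff_f Q by cases auto
  qed
  have cg: "coeff g k = of_real ((if k \<ge> 3 then A (k - 3) else 0)
      - ?\<alpha> * (if k \<ge> 1 then A (k - 1) else 0) - ?\<beta> * A k) - coeff f k" for k
    unfolding g by (auto simp: coeff_pCons cp split: nat.split)
  have high: "coeff g k = 0" if "k > n" for k
  proof -
    consider "k = n + 1" | "k = n + 2" | "k = n + 3" | "k > n + 3" using \<open>k > n\<close> by linarith
    thus ?thesis
    proof cases
      case 1
      hence "k - 3 = n - 2" "k - 1 = n" using n by auto
      hence "coeff g k = of_real (a (n - 2) - ?\<alpha> * a n - \<epsilon> * a (n - 2))"
        using 1 n by (simp add: cg cf A_def)
      also have "a (n - 2) - ?\<alpha> * a n - \<epsilon> * a (n - 2) = 0"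
        using \<alpha>(2) by (simp add: algebra_simps)
      finally show ?thesis by simp
    qed (use n in \<open>auto simp: cg cf A_def\<close>)
  qed
  thus "degree g \<le> n" by (intro degree_le) auto
  show "coeff g k \<in> \<real>\<^sub>\<le>\<^sub>0"
  proof (cases "k \<le> n")
    case True
    have "(if k \<ge> 3 then A (k - 3) else 0)
      - ?\<alpha> * (if k \<ge> 1 then A (k - 1) else 0) - ?\<beta> * A k \<le> 0" (is "?c \<le> 0")
    proof (cases "k \<ge> 3")
      case k: True
      have "k - 3 + 2 = k - 1" "k - 3 + 3 = k" "k - 3 \<le> n - 3" "k - 1 \<le> n" using k True by auto
      thus ?thesis using step[of "k - 3"] k True by (simp add: A_def)
    next
      case False
      have "0 \<le> ?\<alpha> * A (k - 1)" "0 \<le> ?\<beta> * A k" using \<alpha>(1) \<beta> A by auto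
      thus ?thesis using False by auto
    qed
    moreover have "coeff g k = of_real ?c" using True by (simp add: cg cf)
    ultimately show ?thesis by (simp only: nonpos_Reals_of_real_iff)
  qed (simp add: high)
qed

text \<open>
  The value of \<open>|g(\<mu>)|\<close> is supplied as a hypothesis in the form that lets the growth bound be
  compared with \<open>|f(z)| = A |z|^n |z| |z - c\<^sub>1| |z - c\<^sub>2|\<close>: beyond the disks each of the last three
  factors exceeds \<open>r\<close>.
\<close>
lemma dominated_outside_disks:
  fixes f g :: "complex poly"
  assumes nonpos: "\<And>k. coeff g k \<in> \<real>\<^sub>\<le>\<^sub>0" and deg: "degree g \<le> n"
    and f: "f = smult (of_real A) ([:0, 1:] ^ (n + 1) * ([:- c1, 1:] * [:- c2, 1:]))"
    and "0 < A" "0 < \<mu>" "\<mu> \<le> r"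
    and at_mu: "cmod (poly g (of_real \<mu>)) = A * \<mu> ^ n * r ^ 3"
    and out: "r < cmod z" "r < cmod (z - c1)" "r < cmod (z - c2)"
  shows "cmod (poly g z) < cmod (poly f z)"
proof -
  have "0 \<le> r" using \<open>0 < \<mu>\<close> \<open>\<mu> \<le> r\<close> by linarith
  have "r ^ 3 < cmod z * cmod (z - c1) * cmod (z - c2)"
    unfolding power3_eq_cube using out \<open>0 \<le> r\<close>
    by (intro mult_strict_mono mult_nonneg_nonneg mult_pos_pos) auto
  hence *: "cmod z ^ n * A * r ^ 3 < cmod z ^ n * A * (cmod z * cmod (z - c1) * cmod (z - c2))"
    using \<open>0 < A\<close> \<open>0 \<le> r\<close> out(1) by (intro mult_strict_left_mono mult_pos_pos zero_less_power) auto
  have "poly f z = of_real A * (z ^ (n + 1) * ((z - c1) * (z - c2)))"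
    by (simp add: f poly_power) (simp add: algebra_simps)
  hence "cmod (poly f z) = A * (cmod z ^ (n + 1) * (cmod (z - c1) * cmod (z - c2)))"
    using \<open>0 < A\<close> by (simp only: norm_mult norm_power norm_of_real abs_of_pos)
  hence fz: "cmod (poly f z) = cmod z ^ n * A * (cmod z * cmod (z - c1) * cmod (z - c2))"
    by (simp add: mult_ac)
  have "\<mu> ^ n * cmod (poly g z) \<le> cmod z ^ n * (A * \<mu> ^ n * r ^ 3)"
    using nonpos_coeffs_growth[OF nonpos deg \<open>0 < \<mu>\<close>, of z] at_mu out(1) \<open>\<mu> \<le> r\<close> by simp
  also have "\<dots> = \<mu> ^ n * (cmod z ^ n * A * r ^ 3)" by (simp add: mult_ac)
  also have "\<dots> < \<mu> ^ n * cmod (poly f z)"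
    unfolding fz using \<open>0 < \<mu>\<close> by (intro mult_strict_left_mono[OF *] zero_less_power)
  finally show ?thesis using \<open>0 < \<mu>\<close> by simp
qed

lemma disjnt_cball_iff:
  fixes x y :: "'a :: real_normed_vector"
  assumes "0 \<le> r"
  shows "disjnt (cball x r) (cball y r) \<longleftrightarrow> 2 * r < dist x y"
proof
  assume "disjnt (cball x r) (cball y r)"
  hence "midpoint x y \<notin> cball x r \<or> midpoint x y \<notin> cball y r"
    by (auto simp: disjnt_iff)
  thus "2 * r < dist x y" by (auto simp: dist_midpoint)
next
  assume "2 * r < dist x y"
  hence "\<not> (dist x z \<le> r \<and> dist y z \<le> r)" for z
    using dist_triangle2[of x y z] by linarith
  thus "disjnt (cball x r) (cball y r)" by (auto simp: disjnt_iff)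
qed

text \<open>
  Different moduli exclude a conjugate pair, and real roots with negative sum and positive product
  are both negative.
\<close>
lemma positive_quadratic_roots_real_negative:
  fixes c1 c2 :: complex and b c :: real
  assumes "c1 + c2 = - of_real b" "c1 * c2 = of_real c" "0 < b" "0 < c" "cmod c1 \<noteq> cmod c2"
  shows "c1 \<in> \<real> \<and> c2 \<in> \<real> \<and> Re c1 < 0 \<and> Re c2 < 0"
proof -
  have im: "Im c2 = - Im c1" and re: "Re c1 + Re c2 = - b"
    using assms(1) by (auto simp: complex_eq_iff add_eq_0_iff)
  have "Re c1 * Im c2 + Im c1 * Re c2 = 0" using assms(2) by (auto simp: complex_eq_iff)
  hence "Im c1 * (Re c2 - Re c1) = 0" by (simp add: im algebra_simps)
  moreover have "Re c1 \<noteq> Re c2" using assms(5) by (auto simp: cmod_def im)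
  ultimately have "Im c1 = 0" by simp
  hence "Re c1 * Re c2 = c" using assms(2) by (auto simp: complex_eq_iff im)
  hence "0 < Re c1 * Re c2" using \<open>0 < c\<close> by simp
  hence "Re c1 < 0 \<and> Re c2 < 0" using re \<open>0 < b\<close> by (auto simp: zero_less_mult_iff)
  thus ?thesis using \<open>Im c1 = 0\<close> im by (auto simp: complex_is_Real_iff)
qed

section \<open>Location and separation of the zeros\<close>

theorem theorem6p1:
  fixes a :: "nat \<Rightarrow> real" and n :: nat and p :: "complex poly"
    and \<epsilon> \<mu> R :: real and c1 c2 :: complex and D0 D1 D2 :: "complex set"
  assumes n: "n \<ge> 3"
    and a_pos: "\<forall>j\<le>n. a j > 0"
    and p: "p = (\<Sum>j\<le>n. monom (complex_of_real (a j)) j)"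
    and eps: "0 < \<epsilon>" "\<epsilon> \<le> 1"
    and mu: "\<mu> = (THE x. 0 < x \<and> x ^ 3 - gamma1 a n \<epsilon> * x - gamma0 a n \<epsilon> = 0)"
    and R: "R = \<mu> ^ 3 + a (n - 1) / a n * \<mu> ^ 2 + \<epsilon> * (a (n - 2) / a n) * \<mu>"
    and c12: "proots [:complex_of_real (\<epsilon> * (a (n - 2) / a n)),
                       complex_of_real (a (n - 1) / a n), 1:] = {#c1, c2#}"
    and D0: "D0 = {z. cmod z \<le> root 3 R}"
    and D1: "D1 = {z. cmod (z - c1) \<le> root 3 R}"
    and D2: "D2 = {z. cmod (z - c2) \<le> root 3 R}"
  shows "(\<exists>!x::real. 0 < x \<and> x ^ 3 - gamma1 a n \<epsilon> * x - gamma0 a n \<epsilon> = 0) \<and>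
    ({z. poly p z = 0} \<subseteq> D0 \<union> D1 \<union> D2) \<and>
    (some_disk_isolated D0 D1 D2 \<longrightarrow>
           scenario1 D0 D1 D2 \<or> scenario2 D0 D1 D2 \<or> scenario2 D0 D2 D1) \<and>
    (scenario1 D0 D1 D2 \<longrightarrow>
           zeros_in p D0 = n - 2 \<and> zeros_in p (D1 \<union> D2) = 2 \<and>
           (disjnt D1 D2 \<longrightarrow> zeros_in p D1 = 1 \<and> zeros_in p D2 = 1)) \<and>
    (scenario2 D0 D1 D2 \<longrightarrow> zeros_in p D1 = 1 \<and> zeros_in p (D0 \<union> D2) = n - 1) \<and>
    (scenario2 D0 D2 D1 \<longrightarrow> zeros_in p D2 = 1 \<and> zeros_in p (D0 \<union> D1) = n - 1) \<and>
    (scenario2 D0 D1 D2 \<or> scenario2 D0 D2 D1 \<longrightarrow>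
           c1 \<in> \<real> \<and> c2 \<in> \<real> \<and> Re c1 < 0 \<and> Re c2 < 0)"
proof -
  let ?\<alpha> = "gamma1 a n \<epsilon>" and ?\<beta> = "gamma0 a n \<epsilon>"
  let ?b = "a (n - 1) / a n" and ?c = "\<epsilon> * (a (n - 2) / a n)"
  define r where "r = root 3 R"
  define h :: "complex poly" where "h = [:- of_real ?\<beta>, - of_real ?\<alpha>, 0, 1:]"
  define f :: "complex poly" where "f = smult (of_real (a n)) ([:0, 1:] ^ (n + 1) * [:of_real ?c, of_real ?b, 1:])"
  define g where "g = h * p - f"
  have pos: "a n > 0" "a (n - 1) > 0" "a (n - 2) > 0" "a 0 > 0" "a 3 > 0"
    using a_pos n by auto
  hence "?b > 0" "?c > 0" using eps by auto

  have \<alpha>\<beta>: "?\<alpha> \<ge> 0" "?\<beta> \<ge> 0"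
    using pos eps by (auto simp: gamma1_def gamma0_def)
  \<comment> \<open>The cubic never degenerates to \<open>z^3\<close>: for \<open>\<gamma>\<^sub>1 = 0\<close> the ratio \<open>a\<^sub>0 / a\<^sub>3\<close> bounds \<open>\<gamma>\<^sub>0\<close> from below.\<close>
  have "?\<beta> \<noteq> 0" if "?\<alpha> = 0"
  proof -
    have "0 < (a 0 - ?\<alpha> * a (0 + 2)) / a (0 + 3)" using pos that by simp
    also have "\<dots> \<le> ?\<beta>" unfolding gamma0_def by (intro max.coboundedI2 Max_ge imageI) auto
    finally show ?thesis by simp
  qed
  hence ex1: "\<exists>!x::real. 0 < x \<and> x ^ 3 - ?\<alpha> * x - ?\<beta> = 0"
    using cubic_unique_positive_root[OF \<alpha>\<beta>] by blast
  have \<mu>: "0 < \<mu>" "\<mu> ^ 3 - ?\<alpha> * \<mu> - ?\<beta> = 0"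
    using theI'[OF ex1] unfolding mu by auto

  have "0 \<le> ?b * \<mu>\<^sup>2" "0 \<le> ?c * \<mu>"
    using mult_pos_pos[OF \<open>?b > 0\<close>, of "\<mu>\<^sup>2"] mult_pos_pos[OF \<open>?c > 0\<close> \<mu>(1)] \<mu>(1)
    by (simp_all only: less_imp_le zero_less_power)
  hence "\<mu> ^ 3 \<le> R" unfolding R by linarith
  hence "root 3 (\<mu> ^ 3) \<le> r" unfolding r_def by simp
  hence "\<mu> \<le> r" using \<mu>(1) by (simp add: real_root_power_cancel)
  hence "0 \<le> r" using \<mu>(1) by simp
  have "r ^ 3 = R" unfolding r_def by (simp add: odd_real_root_pow)

  have quadratic: "[:of_real ?c, of_real ?b, 1:] = [:- c1, 1:] * [:- c2, 1:]"
    using complex_poly_decompose_multiset[of "[:of_real ?c, of_real ?b, 1:]"] unfolding c12 by simp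
  hence f_eq: "f = smult (of_real (a n)) ([:0, 1:] ^ (n + 1) * ([:- c1, 1:] * [:- c2, 1:]))"
    unfolding f_def by (rule arg_cong)
  have "of_real ?b = - c2 - c1" "of_real ?c = c1 * c2"
    using quadratic by (simp_all only: mult_pCons_left) simp_all
  hence vieta: "c1 + c2 = - of_real ?b" "c1 * c2 = of_real ?c" by simp_all

  have g_coeffs: "coeff g k \<in> \<real>\<^sub>\<le>\<^sub>0" "degree g \<le> n" for k
    using cubic_product_remainder_nonpos[OF n a_pos eps p f_def] unfolding g_def h_def by blast+
  have "poly h (of_real \<mu>) = of_real (\<mu> ^ 3 - ?\<alpha> * \<mu> - ?\<beta>)"
    by (simp add: h_def power3_eq_cube algebra_simps)
  hence "poly g (of_real \<mu>) = - poly f (of_real \<mu>)" by (simp add: g_def \<mu>(2))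
  also have "poly f (of_real \<mu>) = of_real (a n * (\<mu> ^ (n + 1) * (\<mu>\<^sup>2 + ?b * \<mu> + ?c)))"
    by (simp add: f_def poly_power power2_eq_square algebra_simps)
  also have "a n * (\<mu> ^ (n + 1) * (\<mu>\<^sup>2 + ?b * \<mu> + ?c)) = a n * \<mu> ^ n * R"
    by (simp add: R power2_eq_square power3_eq_cube algebra_simps)
  finally have "poly g (of_real \<mu>) = - of_real (a n * \<mu> ^ n * r ^ 3)"
    by (simp only: \<open>r ^ 3 = R\<close>)
  hence "cmod (poly g (of_real \<mu>)) = \<bar>a n * \<mu> ^ n * r ^ 3\<bar>"
    by (simp only: norm_minus_cancel norm_of_real)
  hence at_mu: "cmod (poly g (of_real \<mu>)) = a n * \<mu> ^ n * r ^ 3"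
    using pos \<mu>(1) \<open>0 \<le> r\<close> by simp

  have D: "D0 = cball 0 r" "D1 = cball c1 r" "D2 = cball c2 r"
    by (auto simp: D0 D1 D2 r_def dist_norm norm_minus_commute)
  have less: "cmod (poly g z) < cmod (poly f z)" if "z \<notin> D0 \<union> D1 \<union> D2" for z
    using that
    by (intro dominated_outside_disks[OF g_coeffs f_eq pos(1) \<mu>(1) \<open>\<mu> \<le> r\<close> at_mu])
      (auto simp: D dist_norm norm_minus_commute)
  have q: "f + g = h * p" by (simp add: g_def)
  have zeros: "{z. poly p z = 0} \<subseteq> D0 \<union> D1 \<union> D2"
  proof
    fix z assume "z \<in> {z. poly p z = 0}"
    hence "poly f z + poly g z = 0" using arg_cong[OF q, of "\<lambda>u. poly u z"] by simp
    hence "cmod (poly f z) = cmod (poly g z)" by (simp add: add_eq_0_iff)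
    thus "z \<in> D0 \<union> D1 \<union> D2" using less[of z] by auto
  qed

  have "coeff p k = (if k \<le> n then of_real (a k) else 0)" for k by (simp add: p coeff_sum)
  hence "degree p = n" and "coeff p n \<noteq> 0"
    using pos(1) by (auto intro!: antisym degree_le le_degree)
  hence "p \<noteq> 0" by auto
  have "h \<noteq> 0" by (simp add: h_def)
  have count_q: "zeros_in (f + g) S = zeros_in h S + zeros_in p S" for S
    unfolding q using \<open>h \<noteq> 0\<close> \<open>p \<noteq> 0\<close> by (rule zeros_in_mult)
  have count_f: "zeros_in f S = (if 0 \<in> S then n + 1 else 0) + (if c1 \<in> S then 1 else 0)
      + (if c2 \<in> S then 1 else 0)" for S
  proof -
    have linear_power: "zeros_in ([:0, 1:] ^ (n + 1)) S = (if 0 \<in> S then n + 1 else 0)"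
      using zeros_in_linear[of 0 S] unfolding zeros_in_power by simp
    have "[:0, 1:] ^ (n + 1) \<noteq> (0 :: complex poly)"
      and "[:- c1, 1:] * [:- c2, 1:] \<noteq> 0" "[:- c1, 1:] \<noteq> 0" "[:- c2, 1:] \<noteq> 0"
      by (simp_all only: power_eq_0_iff mult_eq_0_iff) simp_all
    moreover have "complex_of_real (a n) \<noteq> 0" using pos(1) by simp
    ultimately show ?thesis unfolding f_eq
      by (simp only: zeros_in_smult zeros_in_mult zeros_in_linear linear_power add.assoc not_False_eq_True)
  qed
  have h_zeros: "{z. poly h z = 0} \<subseteq> D0"
  proof
    fix z assume "z \<in> {z. poly h z = 0}"
    hence "z ^ 3 - of_real ?\<alpha> * z - of_real ?\<beta> = 0"
      by (simp add: h_def power3_eq_cube algebra_simps)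
    from cubic_roots_bound[OF \<alpha>\<beta> \<mu> this] show "z \<in> D0" using \<open>\<mu> \<le> r\<close> by (simp add: D)
  qed
  have h_in: "zeros_in h D0 = 3"
    using zeros_in_superset[OF h_zeros] by (simp add: h_def)
  have h_out: "zeros_in h S = 0" if "disjnt D0 S" for S
    using zeros_in_complementary[of h D0 S] h_zeros h_in that by (auto simp: h_def)
  have isolated: "zeros_in (f + g) (cball x r) = zeros_in f (cball x r)"
    if "closed T" "disjnt (cball x r) T" "D0 \<union> D1 \<union> D2 \<subseteq> cball x r \<union> T" for x T
    using \<open>0 \<le> r\<close> that(1,2)
  proof (rule zeros_in_isolated_disk)
    show "cmod (poly g z) < cmod (poly f z)" if "z \<notin> cball x r" "z \<notin> T" for z
      using that \<open>D0 \<union> D1 \<union> D2 \<subseteq> cball x r \<union> T\<close> by (intro less) blast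
  qed

  have centers: "0 \<in> D0" "c1 \<in> D1" "c2 \<in> D2" using \<open>0 \<le> r\<close> by (auto simp: D)
  have isolated0: "zeros_in p D0 = n - 2" if "disjnt D0 (D1 \<union> D2)"
  proof -
    have "zeros_in (f + g) D0 = zeros_in f D0"
      using isolated[of "D1 \<union> D2" 0] that by (auto simp: D)
    moreover have "c1 \<notin> D0" "c2 \<notin> D0" using that centers by (auto simp: disjnt_iff)
    ultimately show ?thesis using centers by (simp add: count_q count_f h_in)
  qed
  have isolated1: "zeros_in p D1 = 1" if "disjnt D1 (D0 \<union> D2)"
  proof -
    have "zeros_in (f + g) D1 = zeros_in f D1"
      using isolated[of "D0 \<union> D2" c1] that by (auto simp: D)
    moreover have "0 \<notin> D1" "c2 \<notin> D1" using that centers by (auto simp: disjnt_iff)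
    moreover have "zeros_in h D1 = 0" using that by (intro h_out) (auto simp: disjnt_iff)
    ultimately show ?thesis using centers by (simp add: count_q count_f)
  qed
  have isolated2: "zeros_in p D2 = 1" if "disjnt D2 (D0 \<union> D1)"
  proof -
    have "zeros_in (f + g) D2 = zeros_in f D2"
      using isolated[of "D0 \<union> D1" c2] that by (auto simp: D)
    moreover have "0 \<notin> D2" "c1 \<notin> D2" using that centers by (auto simp: disjnt_iff)
    moreover have "zeros_in h D2 = 0" using that by (intro h_out) (auto simp: disjnt_iff)
    ultimately show ?thesis using centers by (simp add: count_q count_f)
  qed
  note complementary = zeros_in_complementary[of p, unfolded \<open>degree p = n\<close>]

  have "some_disk_isolated D0 D1 D2 \<longrightarrow>
      scenario1 D0 D1 D2 \<or> scenario2 D0 D1 D2 \<or> scenario2 D0 D2 D1"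
    by (auto simp: some_disk_isolated_def scenario1_def scenario2_def disjnt_sym disjnt_Un1 disjnt_Un2)
  moreover have "zeros_in p D0 = n - 2 \<and> zeros_in p (D1 \<union> D2) = 2 \<and>
      (disjnt D1 D2 \<longrightarrow> zeros_in p D1 = 1 \<and> zeros_in p D2 = 1)" if "scenario1 D0 D1 D2"
  proof (intro conjI impI)
    have iso: "disjnt D0 (D1 \<union> D2)" using that by (auto simp: scenario1_def disjnt_iff)
    show "zeros_in p D0 = n - 2" by (rule isolated0[OF iso])
    thus "zeros_in p (D1 \<union> D2) = 2"
      using complementary[OF _ iso] zeros n by (simp add: Un_assoc)
    assume "disjnt D1 D2"
    hence "disjnt D1 (D0 \<union> D2)" "disjnt D2 (D0 \<union> D1)" using iso by (auto simp: disjnt_iff)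
    thus "zeros_in p D1 = 1" "zeros_in p D2 = 1"
      using isolated1 isolated2 by blast+
  qed
  moreover have "zeros_in p D1 = 1 \<and> zeros_in p (D0 \<union> D2) = n - 1" if "scenario2 D0 D1 D2"
  proof -
    have iso: "disjnt D1 (D0 \<union> D2)" using that by (auto simp: scenario2_def disjnt_iff)
    show ?thesis using isolated1[OF iso] complementary[OF _ iso] zeros by auto
  qed
  moreover have "zeros_in p D2 = 1 \<and> zeros_in p (D0 \<union> D1) = n - 1" if "scenario2 D0 D2 D1"
  proof -
    have iso: "disjnt D2 (D0 \<union> D1)" using that by (auto simp: scenario2_def disjnt_iff)
    show ?thesis using isolated2[OF iso] complementary[OF _ iso] zeros by auto
  qed
  moreover have "c1 \<in> \<real> \<and> c2 \<in> \<real> \<and> Re c1 < 0 \<and> Re c2 < 0"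
    if "scenario2 D0 D1 D2 \<or> scenario2 D0 D2 D1"
  proof (rule positive_quadratic_roots_real_negative[OF vieta \<open>?b > 0\<close> \<open>?c > 0\<close>])
    show "cmod c1 \<noteq> cmod c2"
      using that \<open>0 \<le> r\<close> by (auto simp: scenario2_def D disjnt_cball_iff)
  qed
  ultimately show ?thesis using ex1 zeros by blast
qed

end
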